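(* Let $\Omega=[a,b]\subset\mathbb{R}$ be a bounded interval and let $\mathcal{X}_{n+1}=\{x_i\}_{i=0,\dots,n}\subset\Omega$, $n\in\mathbb{N}$, be a set of distinct nodes, sorted in increasing order. Let $\xi_1<\dots<\xi_d\in\Omega\setminus\{a,b\}$, $d\in\mathbb{N}$, $d\ge 2$, and let $\Omega^1=[a,\xi_1]$, $\Omega^{d+1}=\,]\xi_d,b]$ and $\Omega^i=\,]\xi_{i-1},\xi_i]$ for $i=2,\dots,d$. Let $\mathcal{X}^\nu=\mathcal{X}_{n+1}\cap\Omega^\nu$ for $\nu=1,\dots,d+1$, and assume that $$|\mathcal{X}^\nu|-|\mathcal{X}^\tau|\in\{-1,0,1\}\qquad\text{for all }\nu,\tau=1,\dots,d+1.$$ For $\kappa>0$ consider the map $S_\kappa:\Omega\to\mathbb{R}$ defined by $S_\kappa(x)=x+(\tau-1)\kappa$ for $x\in\Omega^\tau$, $\tau=1,\dots,d+1$. For $x_i\in\mathcal{X}^\mu$, let $\ell_{i,\mu}^\kappa$ denote the $i$-th mapped Lagrange function associated with $S_\kappa$ and $\mathcal{X}_{n+1}$, and let $|\ell_{i,\mu}^\infty(x)|=\lim_{\kappa\to\infty}|\ell_{i,\mu}^\kappa(x)|$. Then, for $x\in\Omega^\mu$, $$|\ell_{i,\mu}^\infty(x)|=\prod_{\substack{x_j\in\mathcal{X}^\mu\\ j\ne i}}\left|\frac{x-x_j}{x_i-x_j}\right|.$$ On the other hand, if $\tau\ne\mu$ and $x\in\Omega^\tau$, then $$|\ell_{i,\mu}^\infty(x)|=\begin{cases}0,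 \text{ with } |\ell_{i,\mu}^\kappa(x)|=O(\kappa^{-1}) \text{ as }\kappa\to\infty, & \text{if } |\mathcal{X}^\tau|=|\mathcal{X}^\mu|,\\ 0, \text{ with } |\ell_{i,\mu}^\kappa(x)|=O(\kappa^{-2})\text{ as }\kappa\to\infty, & \text{if } |\mathcal{X}^\tau|=|\mathcal{X}^\mu|+1,\\ |r_{i,\mu,\tau}(x)|\,C_{\mu,\tau}, & \text{if } |\mathcal{X}^\tau|=|\mathcal{X}^\mu|-1,\end{cases}$$ where $$C_{\mu,\tau}=\prod_{\substack{\nu=1\\ \nu\ne\mu,\tau}}^{d+1}\left|\frac{\tau-\nu}{\mu-\nu}\right|^{|\mathcal{X}^\nu|},\qquad r_{i,\mu,\tau}(x)=\prod_{x_j\in\mathcal{X}^\tau}(x-x_j)\prod_{\substack{x_j\in\mathcal{X}^\mu\\ j\ne i}}\frac{1}{x_i-x_j}.$$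
   Context: The mapped Lagrange functions associated with the map $S_\kappa$ and the nodes $\mathcal{X}_{n+1}$ are $$\ell_i^\kappa(x)=\prod_{\substack{j=0\\ j\ne i}}^n\frac{S_\kappa(x)-S_\kappa(x_j)}{S_\kappa(x_i)-S_\kappa(x_j)},\qquad i=0,\dots,n,\ x\in\Omega;$$ the notation $\ell^\kappa_{i,\mu}$ means $\ell^\kappa_i$ when $x_i\in\mathcal{X}^\mu$. Empty products equal $1$. *)

theory Defs
  imports Complex_Main "HOL-Library.Landau_Symbols"
begin

text \<open>The breakpoints are \<open>\<xi> 1 < \<dots> < \<xi> d\<close>; pieces are numbered \<open>1, \<dots>, d + 1\<close>.\<close>

definition piece :: "real \<Rightarrow> real \<Rightarrow> nat \<Rightarrow> (nat \<Rightarrow> real) \<Rightarrow> nat \<Rightarrow> real set" where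
  "piece a b d \<xi> \<nu> =
     (if \<nu> = 1 then {a..\<xi> 1}
      else if \<nu> = d + 1 then {\<xi> d<..b}
      else {\<xi> (\<nu> - 1)<..\<xi> \<nu>})"

definition nodes :: "nat \<Rightarrow> (nat \<Rightarrow> real) \<Rightarrow> real set" where
  "nodes n X = X ` {0..n}"

definition piece_nodes ::
    "real \<Rightarrow> real \<Rightarrow> nat \<Rightarrow> (nat \<Rightarrow> real) \<Rightarrow> nat \<Rightarrow> (nat \<Rightarrow> real) \<Rightarrow> nat \<Rightarrow> real set" where
  "piece_nodes a b d \<xi> n X \<nu> = nodes n X \<inter> piece a b d \<xi> \<nu>"

text \<open>
  The value of \<open>shift_map\<close> is meaningful only on \<open>{a..b}\<close>, where the piece containing
  the argument is unique; see \<open>shift_map_eq\<close> below.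
\<close>

definition shift_map :: "real \<Rightarrow> real \<Rightarrow> nat \<Rightarrow> (nat \<Rightarrow> real) \<Rightarrow> real \<Rightarrow> real \<Rightarrow> real" where
  "shift_map a b d \<xi> \<kappa> x =
     x + (real (THE \<tau>. \<tau> \<in> {1..d + 1} \<and> x \<in> piece a b d \<xi> \<tau>) - 1) * \<kappa>"

definition mapped_lagrange ::
    "(real \<Rightarrow> real) \<Rightarrow> nat \<Rightarrow> (nat \<Rightarrow> real) \<Rightarrow> nat \<Rightarrow> real \<Rightarrow> real" where
  "mapped_lagrange S n X i x =
     (\<Prod>j\<in>{0..n} - {i}. (S x - S (X j)) / (S (X i) - S (X j)))"

definition limit_const ::
    "real \<Rightarrow> real \<Rightarrow> nat \<Rightarrow> (nat \<Rightarrow> real) \<Rightarrow> nat \<Rightarrow> (nat \<Rightarrow> real) \<Rightarrow> nat \<Rightarrow> nat \<Rightarrow> real" where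
  "limit_const a b d \<xi> n X \<mu> \<tau> =
     (\<Prod>\<nu>\<in>{1..d + 1} - {\<mu>, \<tau>}.
        \<bar>(real \<tau> - real \<nu>) / (real \<mu> - real \<nu>)\<bar> ^ card (piece_nodes a b d \<xi> n X \<nu>))"

definition limit_factor ::
    "real \<Rightarrow> real \<Rightarrow> nat \<Rightarrow> (nat \<Rightarrow> real) \<Rightarrow> nat \<Rightarrow> (nat \<Rightarrow> real) \<Rightarrow> nat \<Rightarrow> nat \<Rightarrow> nat
      \<Rightarrow> real \<Rightarrow> real" where
  "limit_factor a b d \<xi> n X i \<mu> \<tau> x =
     (\<Prod>j\<in>{j \<in> {0..n}. X j \<in> piece_nodes a b d \<xi> n X \<tau>}. x - X j) *
     (\<Prod>j\<in>{j \<in> {0..n}. X j \<in> piece_nodes a b d \<xi> n X \<mu> \<and> j \<noteq> i}. 1 / (X i - X j))"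

lemma piece_less:
  assumes \<xi>: "strict_mono_on {1..d} \<xi>" and "\<sigma> \<in> {1..d + 1}" "\<tau> \<in> {1..d + 1}" "\<sigma> < \<tau>"
    and x: "x \<in> piece a b d \<xi> \<sigma>" and y: "y \<in> piece a b d \<xi> \<tau>"
  shows "x < y"
proof -
  have "x \<le> \<xi> \<sigma>"
    using x assms(2-4) by (auto simp: piece_def split: if_splits)
  also have "\<xi> \<sigma> \<le> \<xi> (\<tau> - 1)"
    by (rule strict_mono_on_leD[OF \<xi>]) (use assms(2-4) in auto)
  also have "\<xi> (\<tau> - 1) < y"
    using y assms(2-4) by (auto simp: piece_def split: if_splits)
  finally show ?thesis .
qed

lemma shift_map_eq:
  assumes "strict_mono_on {1..d} \<xi>" "\<tau> \<in> {1..d + 1}" "x \<in> piece a b d \<xi> \<tau>"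
  shows "shift_map a b d \<xi> \<kappa> x = x + (real \<tau> - 1) * \<kappa>"
proof -
  have "(THE \<tau>. \<tau> \<in> {1..d + 1} \<and> x \<in> piece a b d \<xi> \<tau>) = \<tau>"
  proof (rule the_equality)
    fix \<sigma> assume "\<sigma> \<in> {1..d + 1} \<and> x \<in> piece a b d \<xi> \<sigma>"
    then show "\<sigma> = \<tau>"
      using piece_less[OF assms(1), of \<sigma> \<tau> x a b x] piece_less[OF assms(1), of \<tau> \<sigma> x a b x] assms
      by (metis less_irrefl linorder_neqE_nat)
  qed (use assms in auto)
  then show ?thesis
    by (simp add: shift_map_def)
qed

end

theory Submission imports Defs begin

text \<open>
  Let \<open>p j\<close> be the number of the piece containing \<open>X j\<close>. On the piece numbered \<open>\<tau>\<close> the shift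
  contributes \<open>(\<tau> - 1) * \<kappa>\<close>, so for \<open>x\<close> in that piece and \<open>X i\<close> in the piece numbered \<open>\<mu>\<close> the
  factor of the mapped Lagrange function belonging to \<open>j\<close> is
  \<open>(x - X j + (\<tau> - p j) * \<kappa>) / (X i - X j + (\<mu> - p j) * \<kappa>)\<close>, a quotient of affine functions
  of \<open>\<kappa>\<close>. Its growth depends only on which of the two slopes vanish. If \<open>p j\<close> differs from both
  \<open>\<tau>\<close> and \<open>\<mu>\<close>, it converges to the ratio of the slopes. If \<open>\<tau> \<noteq> \<mu>\<close>, it is \<open>O(1 / \<kappa>)\<close> for
  \<open>p j = \<tau>\<close> and grows like \<open>\<kappa>\<close> for \<open>p j = \<mu>\<close>. If \<open>\<tau> = \<mu>\<close>, it does not depend on \<open>\<kappa>\<close> for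
  \<open>p j = \<mu>\<close> and tends to \<open>1\<close> otherwise, which is the first claim.

  For \<open>\<tau> \<noteq> \<mu>\<close>, let \<open>t\<close> and \<open>m\<close> be the numbers of nodes in the two pieces. Since \<open>X i\<close> itself
  contributes no factor, the product has at most the order \<open>\<kappa> ^ (m - 1) / \<kappa> ^ t\<close>, and the limit of its
  rescaled absolute value exists (\<open>shifted_product_limit_off_piece\<close>). In the three
  cases of the claim the exponent \<open>m - 1 - t\<close> is \<open>-1\<close>, \<open>-2\<close> and \<open>0\<close>. In the last one, the powers of \<open>\<bar>\<tau> - \<mu>\<bar>\<close>
  coming from the slopes of the growing and of the decaying factors cancel, which leaves
  \<open>limit_factor\<close> and \<open>limit_const\<close>.
\<close>

section \<open>Products of quotients of affine functions\<close>

lemma affine_over_self_tendsto: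
  fixes u q :: real
  shows "((\<lambda>\<kappa>. (u + q * \<kappa>) / \<kappa>) \<longlongrightarrow> q) at_top"
proof (rule Lim_transform_eventually)
  have "((\<lambda>\<kappa>. u / \<kappa> + q) \<longlongrightarrow> 0 + q) at_top"
    by (intro tendsto_intros real_tendsto_divide_at_top[OF tendsto_const] filterlim_ident)
  then show "((\<lambda>\<kappa>. u / \<kappa> + q) \<longlongrightarrow> q) at_top"
    by simp
  show "\<forall>\<^sub>F \<kappa> in at_top. u / \<kappa> + q = (u + q * \<kappa>) / \<kappa>"
    using eventually_gt_at_top[of 0] by eventually_elim (simp add: field_simps)
qed

lemma affine_quotient_tendsto:
  fixes u q v s :: real
  assumes "s \<noteq> 0"
  shows "((\<lambda>\<kappa>. (u + q * \<kappa>) / (v + s * \<kappa>)) \<longlongrightarrow> q / s) at_top"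
proof (rule Lim_transform_eventually)
  show "((\<lambda>\<kappa>. ((u + q * \<kappa>) / \<kappa>) / ((v + s * \<kappa>) / \<kappa>)) \<longlongrightarrow> q / s) at_top"
    by (intro tendsto_divide affine_over_self_tendsto assms)
  show "\<forall>\<^sub>F \<kappa> in at_top.
      ((u + q * \<kappa>) / \<kappa>) / ((v + s * \<kappa>) / \<kappa>) = (u + q * \<kappa>) / (v + s * \<kappa>)"
    using eventually_gt_at_top[of 0] by eventually_elim simp
qed

lemma const_over_affine_tendsto:
  fixes u v s :: real
  assumes "s \<noteq> 0"
  shows "((\<lambda>\<kappa>. u / (v + s * \<kappa>) * \<kappa>) \<longlongrightarrow> u / s) at_top"
  using affine_quotient_tendsto[OF assms, of 0 u v] by simp

text \<open>Only the factors with \<open>p j = \<mu>\<close> survive: in all others numerator and denominator have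
  the same nonzero slope.\<close>

lemma shifted_product_limit_on_piece:
  fixes p y :: "'i \<Rightarrow> real" and x z \<mu> :: real
  assumes "finite J"
  shows "((\<lambda>\<kappa>. \<bar>\<Prod>j\<in>J. (x - y j + (\<mu> - p j) * \<kappa>) / (z - y j + (\<mu> - p j) * \<kappa>)\<bar>) \<longlongrightarrow>
           (\<Prod>j\<in>{j \<in> J. p j = \<mu>}. \<bar>(x - y j) / (z - y j)\<bar>)) at_top"
proof -
  have factor: "((\<lambda>\<kappa>. \<bar>(x - y j + (\<mu> - p j) * \<kappa>) / (z - y j + (\<mu> - p j) * \<kappa>)\<bar>) \<longlongrightarrow>
      (if p j = \<mu> then \<bar>(x - y j) / (z - y j)\<bar> else 1)) at_top" for j
  proof (cases "p j = \<mu>")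
    case False
    then show ?thesis
      using tendsto_rabs[OF affine_quotient_tendsto[of "\<mu> - p j" "x - y j" "\<mu> - p j" "z - y j"]]
      by simp
  qed simp
  show ?thesis
    unfolding abs_prod prod.inter_filter[OF assms] by (intro tendsto_prod factor)
qed

text \<open>The slope of the numerator vanishes for \<open>p j = \<tau>\<close>, that of the denominator for \<open>p j = \<mu>\<close>.
  Multiplying the former factors by \<open>\<kappa>\<close> and dividing the latter by \<open>\<kappa>\<close> makes every factor
  converge, and the weights multiply to the stated powers.\<close>

lemma shifted_product_limit_off_piece:
  fixes p y :: "'i \<Rightarrow> real" and x z \<mu> \<tau> :: real
  assumes J: "finite J" and ne: "\<tau> \<noteq> \<mu>"
  shows "((\<lambda>\<kappa>. \<bar>\<Prod>j\<in>J. (x - y j + (\<tau> - p j) * \<kappa>) / (z - y j + (\<mu> - p j) * \<kappa>)\<bar> *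
             (\<kappa> ^ card {j \<in> J. p j = \<tau>} / \<kappa> ^ card {j \<in> J. p j = \<mu>})) \<longlongrightarrow>
           (\<Prod>j\<in>{j \<in> J. p j = \<tau>}. \<bar>(x - y j) / (\<mu> - \<tau>)\<bar>) *
           (\<Prod>j\<in>{j \<in> J. p j = \<mu>}. \<bar>(\<tau> - \<mu>) / (z - y j)\<bar>) *
           (\<Prod>j\<in>{j \<in> J. p j \<noteq> \<mu> \<and> p j \<noteq> \<tau>}. \<bar>(\<tau> - p j) / (\<mu> - p j)\<bar>)) at_top"
proof -
  define f where "f j \<kappa> = \<bar>(x - y j + (\<tau> - p j) * \<kappa>) / (z - y j + (\<mu> - p j) * \<kappa>)\<bar>" for j \<kappa>
  define w :: "'i \<Rightarrow> real \<Rightarrow> real"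
    where "w j \<kappa> = (if p j = \<tau> then \<kappa> else if p j = \<mu> then 1 / \<kappa> else 1)" for j \<kappa>
  define c where "c j = (if p j = \<tau> then \<bar>(x - y j) / (\<mu> - \<tau>)\<bar>
      else if p j = \<mu> then \<bar>(\<tau> - \<mu>) / (z - y j)\<bar> else \<bar>(\<tau> - p j) / (\<mu> - p j)\<bar>)" for j
  have split: "(\<Prod>j\<in>J. if p j = \<tau> then g j else if p j = \<mu> then h j else k j) =
      (\<Prod>j\<in>{j \<in> J. p j = \<tau>}. g j) * (\<Prod>j\<in>{j \<in> J. p j = \<mu>}. h j) *
      (\<Prod>j\<in>{j \<in> J. p j \<noteq> \<mu> \<and> p j \<noteq> \<tau>}. k j)" for g h k :: "'i \<Rightarrow> real"
  proof -
    have "J \<inter> {j. p j = \<tau>} = {j \<in> J. p j = \<tau>}"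
      "J \<inter> - {j. p j = \<tau>} \<inter> {j. p j = \<mu>} = {j \<in> J. p j = \<mu>}"
      "J \<inter> - {j. p j = \<tau>} \<inter> - {j. p j = \<mu>} = {j \<in> J. p j \<noteq> \<mu> \<and> p j \<noteq> \<tau>}"
      using ne by auto
    then show ?thesis
      using J by (simp add: prod.If_cases mult.assoc)
  qed
  have factor: "((\<lambda>\<kappa>. f j \<kappa> * w j \<kappa>) \<longlongrightarrow> c j) at_top" for j
  proof -
    consider "p j = \<tau>" | "p j = \<mu>" | "p j \<noteq> \<tau>" "p j \<noteq> \<mu>"
      by blast
    then show ?thesis
    proof cases
      case 1
      have "((\<lambda>\<kappa>. \<bar>(x - y j) / (z - y j + (\<mu> - \<tau>) * \<kappa>) * \<kappa>\<bar>) \<longlongrightarrow> c j) at_top"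
        unfolding c_def if_P[OF 1] by (intro tendsto_rabs const_over_affine_tendsto) (use ne in simp)
      then show ?thesis
        by (rule Lim_transform_eventually)
          (use eventually_gt_at_top[of 0] in eventually_elim, simp add: f_def w_def 1 abs_mult)
    next
      case 2
      have "((\<lambda>\<kappa>. \<bar>(x - y j + (\<tau> - \<mu>) * \<kappa>) / \<kappa> / (z - y j)\<bar>) \<longlongrightarrow> c j) at_top"
      proof (cases "z = y j")
        case True
        then show ?thesis
          using 2 ne by (simp add: c_def)
      next
        case False
        then have "((\<lambda>\<kappa>. \<bar>(x - y j + (\<tau> - \<mu>) * \<kappa>) / \<kappa> / (z - y j)\<bar>) \<longlongrightarrow>
            \<bar>(\<tau> - \<mu>) / (z - y j)\<bar>) at_top"
          by (intro tendsto_rabs tendsto_divide affine_over_self_tendsto tendsto_const) simp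
        then show ?thesis
          using 2 ne by (simp add: c_def)
      qed
      then show ?thesis
        by (rule Lim_transform_eventually)
          (use eventually_gt_at_top[of 0] in eventually_elim,
            use ne in \<open>simp add: f_def w_def 2 abs_mult\<close>)
    next
      case 3
      then show ?thesis
        using tendsto_rabs[OF affine_quotient_tendsto[of "\<mu> - p j" "x - y j" "\<tau> - p j" "z - y j"]]
        by (simp add: f_def w_def c_def)
    qed
  qed
  have "(\<Prod>j\<in>J. f j \<kappa> * w j \<kappa>) =
      \<bar>\<Prod>j\<in>J. (x - y j + (\<tau> - p j) * \<kappa>) / (z - y j + (\<mu> - p j) * \<kappa>)\<bar> *
      (\<kappa> ^ card {j \<in> J. p j = \<tau>} / \<kappa> ^ card {j \<in> J. p j = \<mu>})" for \<kappa>
  proof -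
    have "(\<Prod>j\<in>J. w j \<kappa>) = \<kappa> ^ card {j \<in> J. p j = \<tau>} / \<kappa> ^ card {j \<in> J. p j = \<mu>}"
      unfolding w_def split by (simp add: power_divide)
    then show ?thesis
      unfolding prod.distrib f_def abs_prod by simp
  qed
  moreover have "((\<lambda>\<kappa>. \<Prod>j\<in>J. f j \<kappa> * w j \<kappa>) \<longlongrightarrow> (\<Prod>j\<in>J. c j)) at_top"
    by (intro tendsto_prod factor)
  ultimately show ?thesis
    by (simp only: c_def split)
qed

lemma scaled_limit_imp_bigo:
  fixes f :: "real \<Rightarrow> real"
  assumes "((\<lambda>\<kappa>. f \<kappa> * \<kappa> ^ k) \<longlongrightarrow> c) at_top"
  shows "f \<in> O[at_top](\<lambda>\<kappa>. 1 / \<kappa> ^ k)"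
proof (rule bigoI_tendsto)
  show "((\<lambda>\<kappa>. f \<kappa> / (1 / \<kappa> ^ k)) \<longlongrightarrow> c) at_top"
    using assms by simp
  show "\<forall>\<^sub>F \<kappa> in at_top. 1 / \<kappa> ^ k \<noteq> (0 :: real)"
    using eventually_gt_at_top[of 0] by eventually_elim simp
qed

lemma scaled_limit_imp_tendsto_0:
  fixes f :: "real \<Rightarrow> real"
  assumes "((\<lambda>\<kappa>. f \<kappa> * \<kappa> ^ k) \<longlongrightarrow> c) at_top" and "k > 0"
  shows "(f \<longlongrightarrow> 0) at_top"
proof (rule Lim_transform_eventually)
  show "((\<lambda>\<kappa>. f \<kappa> * \<kappa> ^ k / \<kappa> ^ k) \<longlongrightarrow> 0) at_top"
    by (intro real_tendsto_divide_at_top[OF assms(1)] filterlim_pow_at_top assms(2) filterlim_ident)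
  show "\<forall>\<^sub>F \<kappa> in at_top. f \<kappa> * \<kappa> ^ k / \<kappa> ^ k = f \<kappa>"
    using eventually_gt_at_top[of 0] by eventually_elim simp
qed

section \<open>Pieces and mapped Lagrange functions\<close>

lemma piece_cover:
  assumes "d \<ge> 1" and x: "x \<in> {a..b}"
  obtains \<nu> where "\<nu> \<in> {1..d + 1}" and "x \<in> piece a b d \<xi> \<nu>"
proof -
  \<comment> \<open>The first piece whose right end is not exceeded. The last piece is admitted without a
    test, because \<open>\<xi> (d + 1)\<close> is not a breakpoint.\<close>
  define P where "P k \<longleftrightarrow> k \<ge> 1 \<and> (k = d + 1 \<or> x \<le> \<xi> k)" for k
  define \<nu> where "\<nu> = (LEAST k. P k)"
  have last: "P (d + 1)"
    by (simp add: P_def)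
  have P: "P \<nu>" and le: "\<nu> \<le> d + 1"
    unfolding \<nu>_def by (rule LeastI[of P, OF last], rule Least_le[of P, OF last])
  have gt: "\<xi> (\<nu> - 1) < x" if "\<nu> > 1"
  proof -
    have "\<not> P (\<nu> - 1)"
      using not_less_Least[of "\<nu> - 1" P] that by (simp add: \<nu>_def)
    then show ?thesis
      using that by (auto simp: P_def)
  qed
  have "x \<in> piece a b d \<xi> \<nu>"
    using P le gt x assms(1) by (cases "\<nu> = 1") (auto simp: P_def piece_def)
  then show thesis
    using that[of \<nu>] P le by (auto simp: P_def)
qed

lemma piece_unique:
  assumes "strict_mono_on {1..d} \<xi>" "\<sigma> \<in> {1..d + 1}" "\<tau> \<in> {1..d + 1}"
    and "x \<in> piece a b d \<xi> \<sigma>" "x \<in> piece a b d \<xi> \<tau>"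
  shows "\<sigma> = \<tau>"
  using piece_less[OF assms(1-3) _ assms(4,5)] piece_less[OF assms(1,3,2) _ assms(5,4)]
  by (metis less_irrefl linorder_neqE_nat)

lemma mapped_lagrange_shift_map:
  assumes \<xi>: "strict_mono_on {1..d} \<xi>"
    and p: "\<And>j. j \<le> n \<Longrightarrow> p j \<in> {1..d + 1} \<and> X j \<in> piece a b d \<xi> (p j)"
    and "i \<le> n" and x: "\<tau> \<in> {1..d + 1}" "x \<in> piece a b d \<xi> \<tau>"
  shows "mapped_lagrange (shift_map a b d \<xi> \<kappa>) n X i x =
    (\<Prod>j\<in>{0..n} - {i}. (x - X j + (real \<tau> - real (p j)) * \<kappa>) /
                       (X i - X j + (real (p i) - real (p j)) * \<kappa>))"
  unfolding mapped_lagrange_def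
proof (rule prod.cong[OF refl])
  fix j assume "j \<in> {0..n} - {i}"
  then have j: "shift_map a b d \<xi> \<kappa> (X j) = X j + (real (p j) - 1) * \<kappa>"
    using p[of j] by (intro shift_map_eq[OF \<xi>]) auto
  have i: "shift_map a b d \<xi> \<kappa> (X i) = X i + (real (p i) - 1) * \<kappa>"
    using p[of i] \<open>i \<le> n\<close> by (intro shift_map_eq[OF \<xi>]) auto
  show "(shift_map a b d \<xi> \<kappa> x - shift_map a b d \<xi> \<kappa> (X j)) /
      (shift_map a b d \<xi> \<kappa> (X i) - shift_map a b d \<xi> \<kappa> (X j)) =
      (x - X j + (real \<tau> - real (p j)) * \<kappa>) / (X i - X j + (real (p i) - real (p j)) * \<kappa>)"
    unfolding i j shift_map_eq[OF \<xi> x] by (simp add: algebra_simps)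
qed

text \<open>A node in the piece numbered \<open>\<nu>\<close> contributes the ratio of slopes \<open>(\<tau> - \<nu>) / (\<mu> - \<nu>)\<close>, so the
  nodes of that piece together contribute a power of it.\<close>

lemma limit_const_eq_prod_nodes:
  assumes p: "\<And>j. j \<le> n \<Longrightarrow> p j \<in> {1..d + 1}"
    and card: "\<And>\<nu>. \<nu> \<in> {1..d + 1} \<Longrightarrow> card (piece_nodes a b d \<xi> n X \<nu>) = card {j \<in> {0..n}. p j = \<nu>}"
  shows "limit_const a b d \<xi> n X \<mu> \<tau> =
    (\<Prod>j\<in>{j \<in> {0..n}. p j \<noteq> \<mu> \<and> p j \<noteq> \<tau>}. \<bar>(real \<tau> - real (p j)) / (real \<mu> - real (p j))\<bar>)"
proof -
  let ?J = "{j \<in> {0..n}. p j \<noteq> \<mu> \<and> p j \<noteq> \<tau>}" and ?N = "{1..d + 1} - {\<mu>, \<tau>}"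
  let ?g = "\<lambda>\<nu>. \<bar>(real \<tau> - real \<nu>) / (real \<mu> - real \<nu>)\<bar>"
  have "(\<Prod>j\<in>?J. ?g (p j)) = (\<Prod>\<nu>\<in>?N. \<Prod>j\<in>{j \<in> ?J. p j = \<nu>}. ?g (p j))"
    by (rule prod.group[symmetric]) (use p in auto)
  also have "\<dots> = (\<Prod>\<nu>\<in>?N. ?g \<nu> ^ card (piece_nodes a b d \<xi> n X \<nu>))"
  proof (rule prod.cong[OF refl])
    fix \<nu> assume \<nu>: "\<nu> \<in> ?N"
    then have "{j \<in> ?J. p j = \<nu>} = {j \<in> {0..n}. p j = \<nu>}"
      by auto
    then show "(\<Prod>j\<in>{j \<in> ?J. p j = \<nu>}. ?g (p j)) = ?g \<nu> ^ card (piece_nodes a b d \<xi> n X \<nu>)"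
      using \<nu> card[of \<nu>] by simp
  qed
  finally show ?thesis
    by (simp add: limit_const_def)
qed

section \<open>The limits of the mapped Lagrange functions\<close>

theorem theorem2:
  fixes a b :: real and n d i \<mu> :: nat and X \<xi> :: "nat \<Rightarrow> real"
  defines "\<Omega> \<equiv> piece a b d \<xi>"
    and "XX \<equiv> piece_nodes a b d \<xi> n X"
    and "ell \<equiv> (\<lambda>\<kappa>. mapped_lagrange (shift_map a b d \<xi> \<kappa>) n X i)"
  assumes "strict_mono_on {0..n} X"
    and "X ` {0..n} \<subseteq> {a..b}"
    and "d \<ge> 2"
    and "strict_mono_on {1..d} \<xi>"
    and "\<xi> ` {1..d} \<subseteq> {a..b} - {a, b}"
    and "\<forall>\<nu>\<in>{1..d + 1}. \<forall>\<tau>\<in>{1..d + 1}. int (card (XX \<nu>)) - int (card (XX \<tau>)) \<in> {-1, 0, 1}"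
    and "\<mu> \<in> {1..d + 1}"
    and "i \<in> {0..n}"
    and "X i \<in> XX \<mu>"
  shows "(\<forall>x\<in>\<Omega> \<mu>. ((\<lambda>\<kappa>. \<bar>ell \<kappa> x\<bar>) \<longlongrightarrow>
              (\<Prod>j\<in>{j \<in> {0..n}. X j \<in> XX \<mu> \<and> j \<noteq> i}. \<bar>(x - X j) / (X i - X j)\<bar>)) at_top) \<and>
         (\<forall>\<tau>\<in>{1..d + 1}. \<tau> \<noteq> \<mu> \<longrightarrow> (\<forall>x\<in>\<Omega> \<tau>.
            (card (XX \<tau>) = card (XX \<mu>) \<longrightarrow>
               ((\<lambda>\<kappa>. \<bar>ell \<kappa> x\<bar>) \<longlongrightarrow> 0) at_top \<and>
               (\<lambda>\<kappa>. \<bar>ell \<kappa> x\<bar>) \<in> O[at_top](\<lambda>\<kappa>. 1 / \<kappa>)) \<and>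
            (card (XX \<tau>) = card (XX \<mu>) + 1 \<longrightarrow>
               ((\<lambda>\<kappa>. \<bar>ell \<kappa> x\<bar>) \<longlongrightarrow> 0) at_top \<and>
               (\<lambda>\<kappa>. \<bar>ell \<kappa> x\<bar>) \<in> O[at_top](\<lambda>\<kappa>. 1 / \<kappa> ^ 2)) \<and>
            (int (card (XX \<tau>)) = int (card (XX \<mu>)) - 1 \<longrightarrow>
               ((\<lambda>\<kappa>. \<bar>ell \<kappa> x\<bar>) \<longlongrightarrow>
                  \<bar>limit_factor a b d \<xi> n X i \<mu> \<tau> x\<bar> * limit_const a b d \<xi> n X \<mu> \<tau>) at_top)))"
proof -
  note X_mono = assms(4) and X_range = assms(5) and \<xi> = assms(7) and \<mu> = assms(10) and Xi = assms(12)
  have i: "i \<le> n"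
    using assms(11) by simp
  have "\<exists>\<nu>. \<nu> \<in> {1..d + 1} \<and> X j \<in> piece a b d \<xi> \<nu>" if "j \<le> n" for j
    using piece_cover[of d "X j" a b \<xi>] assms(6) X_range that by fastforce
  then obtain p where p: "\<And>j. j \<le> n \<Longrightarrow> p j \<in> {1..d + 1} \<and> X j \<in> piece a b d \<xi> (p j)"
    by metis
  have node_iff: "X j \<in> XX \<nu> \<longleftrightarrow> p j = \<nu>" if "j \<le> n" "\<nu> \<in> {1..d + 1}" for j \<nu>
    using piece_unique[OF \<xi>, of "p j" \<nu> "X j" a b] p[OF that(1)] that
    by (auto simp: XX_def piece_nodes_def nodes_def)
  have pi: "p i = \<mu>"
    using node_iff[OF i \<mu>] Xi by simp
  have card: "card (XX \<nu>) = card {j \<in> {0..n}. p j = \<nu>}" if "\<nu> \<in> {1..d + 1}" for \<nu>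
  proof -
    have "XX \<nu> = X ` {j \<in> {0..n}. p j = \<nu>}"
      using node_iff[OF _ that] by (fastforce simp: XX_def piece_nodes_def nodes_def)
    moreover have "inj_on X {j \<in> {0..n}. p j = \<nu>}"
      using strict_mono_on_imp_inj_on[OF X_mono] by (rule inj_on_subset) auto
    ultimately show ?thesis
      by (simp add: card_image)
  qed
  let ?J = "{0..n} - {i}"
  have ell: "ell \<kappa> x = (\<Prod>j\<in>?J. (x - X j + (real \<tau> - real (p j)) * \<kappa>) /
      (X i - X j + (real \<mu> - real (p j)) * \<kappa>))"
    if "\<tau> \<in> {1..d + 1}" "x \<in> \<Omega> \<tau>" for \<kappa> x \<tau>
    unfolding ell_def pi[symmetric] using that p i
    by (intro mapped_lagrange_shift_map[OF \<xi>]) (auto simp: \<Omega>_def)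
  have J_\<mu>: "{j \<in> ?J. real (p j) = real \<mu>} = {j \<in> {0..n}. X j \<in> XX \<mu> \<and> j \<noteq> i}"
    using node_iff[OF _ \<mu>] by auto
  have on_piece: "((\<lambda>\<kappa>. \<bar>ell \<kappa> x\<bar>) \<longlongrightarrow>
      (\<Prod>j\<in>{j \<in> {0..n}. X j \<in> XX \<mu> \<and> j \<noteq> i}. \<bar>(x - X j) / (X i - X j)\<bar>)) at_top"
    if "x \<in> \<Omega> \<mu>" for x
    using shifted_product_limit_on_piece[of ?J x X "real \<mu>" "\<lambda>j. real (p j)" "X i"]
    unfolding J_\<mu> ell[OF \<mu> that] by simp
  have off_piece: "\<exists>c. ((\<lambda>\<kappa>. \<bar>ell \<kappa> x\<bar> * (\<kappa> ^ card (XX \<tau>) / \<kappa> ^ (card (XX \<mu>) - 1))) \<longlongrightarrow> c) at_top \<and>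
      (card (XX \<tau>) = card (XX \<mu>) - 1 \<longrightarrow>
        c = \<bar>limit_factor a b d \<xi> n X i \<mu> \<tau> x\<bar> * limit_const a b d \<xi> n X \<mu> \<tau>)"
    if \<tau>: "\<tau> \<in> {1..d + 1}" and ne: "\<tau> \<noteq> \<mu>" and x: "x \<in> \<Omega> \<tau>" for \<tau> x
  proof -
    define A where "A = {j \<in> {0..n}. X j \<in> XX \<tau>}"
    define B where "B = {j \<in> {0..n}. X j \<in> XX \<mu> \<and> j \<noteq> i}"
    define D where "D = \<bar>real \<tau> - real \<mu>\<bar>"
    have J_\<tau>: "{j \<in> ?J. real (p j) = real \<tau>} = A"
      using node_iff[OF _ \<tau>] pi ne by (auto simp: A_def)
    have J_rest: "{j \<in> ?J. real (p j) \<noteq> real \<mu> \<and> real (p j) \<noteq> real \<tau>} =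
        {j \<in> {0..n}. p j \<noteq> \<mu> \<and> p j \<noteq> \<tau>}"
      using pi by auto
    have "A = {j \<in> {0..n}. p j = \<tau>}"
      using node_iff[OF _ \<tau>] by (auto simp: A_def)
    then have card_A: "card A = card (XX \<tau>)"
      using card[OF \<tau>] by simp
    have "B = {j \<in> {0..n}. p j = \<mu>} - {i}"
      using node_iff[OF _ \<mu>] by (auto simp: B_def)
    then have card_B: "card B = card (XX \<mu>) - 1"
      using card[OF \<mu>] i pi by simp
    have "limit_const a b d \<xi> n X \<mu> \<tau> =
        (\<Prod>j\<in>{j \<in> {0..n}. p j \<noteq> \<mu> \<and> p j \<noteq> \<tau>}. \<bar>(real \<tau> - real (p j)) / (real \<mu> - real (p j))\<bar>)"
      using p card unfolding XX_def by (intro limit_const_eq_prod_nodes) auto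
    then have lim: "((\<lambda>\<kappa>. \<bar>ell \<kappa> x\<bar> * (\<kappa> ^ card (XX \<tau>) / \<kappa> ^ (card (XX \<mu>) - 1))) \<longlongrightarrow>
        (\<Prod>j\<in>A. \<bar>(x - X j) / (real \<mu> - real \<tau>)\<bar>) * (\<Prod>j\<in>B. \<bar>(real \<tau> - real \<mu>) / (X i - X j)\<bar>) *
        limit_const a b d \<xi> n X \<mu> \<tau>) at_top"
      using shifted_product_limit_off_piece[of ?J "real \<tau>" "real \<mu>" x X "\<lambda>j. real (p j)" "X i"] ne
      unfolding J_\<tau> J_\<mu>[folded B_def] J_rest ell[OF \<tau> x] card_A card_B by simp
    \<comment> \<open>Collecting the slopes leaves the factor \<open>D ^ card B / D ^ card A\<close>, which is \<open>1\<close> if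
      \<open>A\<close> and \<open>B\<close> have the same size.\<close>
    have "D \<noteq> 0"
      using ne by (simp add: D_def)
    have "(\<Prod>j\<in>A. \<bar>(x - X j) / (real \<mu> - real \<tau>)\<bar>) = (\<Prod>j\<in>A. \<bar>x - X j\<bar>) / D ^ card A"
      by (simp add: prod_dividef D_def abs_minus_commute)
    moreover have "(\<Prod>j\<in>B. \<bar>(real \<tau> - real \<mu>) / (X i - X j)\<bar>) =
        D ^ card B * (\<Prod>j\<in>B. \<bar>1 / (X i - X j)\<bar>)"
      by (simp add: prod_dividef D_def)
    moreover have "\<bar>limit_factor a b d \<xi> n X i \<mu> \<tau> x\<bar> =
        (\<Prod>j\<in>A. \<bar>x - X j\<bar>) * (\<Prod>j\<in>B. \<bar>1 / (X i - X j)\<bar>)"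
      by (simp only: limit_factor_def abs_mult abs_prod A_def B_def XX_def)
    ultimately have "(\<Prod>j\<in>A. \<bar>(x - X j) / (real \<mu> - real \<tau>)\<bar>) *
        (\<Prod>j\<in>B. \<bar>(real \<tau> - real \<mu>) / (X i - X j)\<bar>) = \<bar>limit_factor a b d \<xi> n X i \<mu> \<tau> x\<bar>"
      if "card (XX \<tau>) = card (XX \<mu>) - 1"
      using that \<open>D \<noteq> 0\<close> by (simp add: card_A card_B)
    then show ?thesis
      by (intro exI[of _ "(\<Prod>j\<in>A. \<bar>(x - X j) / (real \<mu> - real \<tau>)\<bar>) *
          (\<Prod>j\<in>B. \<bar>(real \<tau> - real \<mu>) / (X i - X j)\<bar>) * limit_const a b d \<xi> n X \<mu> \<tau>"]
          conjI impI lim) (simp only:)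
  qed
  have "card (XX \<mu>) > 0"
    using Xi by (auto simp: card_gt_0_iff XX_def piece_nodes_def nodes_def)
  then obtain m where m: "card (XX \<mu>) = Suc m"
    using gr0_implies_Suc by blast
  show ?thesis
  proof (intro conjI ballI impI)
    fix x assume "x \<in> \<Omega> \<mu>"
    then show "((\<lambda>\<kappa>. \<bar>ell \<kappa> x\<bar>) \<longlongrightarrow>
        (\<Prod>j\<in>{j \<in> {0..n}. X j \<in> XX \<mu> \<and> j \<noteq> i}. \<bar>(x - X j) / (X i - X j)\<bar>)) at_top"
      by (rule on_piece)
  next
    fix \<tau> x assume \<tau>: "\<tau> \<in> {1..d + 1}" "\<tau> \<noteq> \<mu>" "x \<in> \<Omega> \<tau>"
    obtain c where c:
      "((\<lambda>\<kappa>. \<bar>ell \<kappa> x\<bar> * (\<kappa> ^ card (XX \<tau>) / \<kappa> ^ (card (XX \<mu>) - 1))) \<longlongrightarrow> c) at_top"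
      and c_balanced: "card (XX \<tau>) = card (XX \<mu>) - 1 \<Longrightarrow>
        c = \<bar>limit_factor a b d \<xi> n X i \<mu> \<tau> x\<bar> * limit_const a b d \<xi> n X \<mu> \<tau>"
      using off_piece[OF \<tau>] by blast
    have scaled: "((\<lambda>\<kappa>. \<bar>ell \<kappa> x\<bar> * \<kappa> ^ k) \<longlongrightarrow> c) at_top" if "card (XX \<tau>) = m + k" for k
      using c
      by (rule Lim_transform_eventually)
        (use eventually_gt_at_top[of 0] in eventually_elim, simp add: m that power_add)
    {
      assume "card (XX \<tau>) = card (XX \<mu>)"
      then have lim: "((\<lambda>\<kappa>. \<bar>ell \<kappa> x\<bar> * \<kappa> ^ 1) \<longlongrightarrow> c) at_top"
        using m by (intro scaled) simp
      show "((\<lambda>\<kappa>. \<bar>ell \<kappa> x\<bar>) \<longlongrightarrow> 0) at_top"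
        using scaled_limit_imp_tendsto_0[OF lim] by simp
      show "(\<lambda>\<kappa>. \<bar>ell \<kappa> x\<bar>) \<in> O[at_top](\<lambda>\<kappa>. 1 / \<kappa>)"
        using scaled_limit_imp_bigo[OF lim] by simp
    next
      assume "card (XX \<tau>) = card (XX \<mu>) + 1"
      then have lim: "((\<lambda>\<kappa>. \<bar>ell \<kappa> x\<bar> * \<kappa> ^ 2) \<longlongrightarrow> c) at_top"
        using m by (intro scaled) simp
      show "((\<lambda>\<kappa>. \<bar>ell \<kappa> x\<bar>) \<longlongrightarrow> 0) at_top"
        using scaled_limit_imp_tendsto_0[OF lim] by simp
      show "(\<lambda>\<kappa>. \<bar>ell \<kappa> x\<bar>) \<in> O[at_top](\<lambda>\<kappa>. 1 / \<kappa> ^ 2)"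
        by (rule scaled_limit_imp_bigo[OF lim])
    next
      assume "int (card (XX \<tau>)) = int (card (XX \<mu>)) - 1"
      then have balanced: "card (XX \<tau>) = m"
        using m by simp
      then show "((\<lambda>\<kappa>. \<bar>ell \<kappa> x\<bar>) \<longlongrightarrow>
          \<bar>limit_factor a b d \<xi> n X i \<mu> \<tau> x\<bar> * limit_const a b d \<xi> n X \<mu> \<tau>) at_top"
        using scaled[of 0] c_balanced m by simp
    }
  qed
qed

end
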